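(* Let $n\ge 7$ and let $\mathcal G$ be a connected bipartite cubic symmetric graph with $2n$ vertices. Then the dimension of the code $\mathcal C(\mathcal G)$ is at most $\frac{5n}{6}$.
   Context: All graphs are finite, without loops and multiple edges. A cubic symmetric graph is a $3$-regular graph that is arc-transitive, i.e. its automorphism group acts transitively on the set of arcs (ordered pairs of adjacent vertices). If $\mathcal G$ is a connected bipartite cubic symmetric graph with $2n$ vertices, order its vertices so that its adjacency matrix is $A=\begin{pmatrix}0&H\\H^T&0\end{pmatrix}$ with $H$ an $n\times n$ $(0,1)$-matrix. The code $\mathcal C(\mathcal G)$ is the binary linear code of length $n$ with parity-check matrix $H$, i.e. $\mathcal C(\mathcal G)=\{x\in\mathbb F_2^n : Hx^T=0\}$, and its dimension is its dimension over $\mathbb F_2$. *)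

theory Defs
  imports
    "HOL-Library.Z2"
    "Graph_Theory.Graph_Theory"
    "Jordan_Normal_Form.Matrix_Kernel"
begin

text \<open>
  Finite graphs without loops and multiple edges are the locale \<open>pair_graph\<close>: an undirected edge
  is a symmetric pair of arcs, so \<open>parcs G\<close> is the set of ordered pairs of adjacent vertices and
  the out-degree is the degree.
\<close>

definition regular_graph :: "nat \<Rightarrow> 'a pair_pre_digraph \<Rightarrow> bool" where
  "regular_graph k G \<longleftrightarrow> pair_graph G \<and> (\<forall>v \<in> pverts G. out_degree (with_proj G) v = k)"

definition automorphism ::
    "('a, 'b) pre_digraph \<Rightarrow> ('a, 'b, 'a, 'b) digraph_isomorphism \<Rightarrow> bool" where
  "automorphism G \<phi> \<longleftrightarrow> pre_digraph.digraph_isomorphism G \<phi> \<and> app_iso \<phi> G = G"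

text \<open>
  For \<open>with_proj G\<close>, the condition \<open>app_iso \<phi> G = G\<close> forces
  \<open>iso_arcs \<phi> (u, v) = (iso_verts \<phi> u, iso_verts \<phi> v)\<close> on arcs, so the action on arcs below is
  the one induced by the vertex permutation.
\<close>

definition arc_transitive :: "('a, 'b) pre_digraph \<Rightarrow> bool" where
  "arc_transitive G \<longleftrightarrow>
     (\<forall>a \<in> arcs G. \<forall>b \<in> arcs G. \<exists>\<phi>. automorphism G \<phi> \<and> iso_arcs \<phi> a = b)"

definition cubic_symmetric_graph :: "'a pair_pre_digraph \<Rightarrow> bool" where
  "cubic_symmetric_graph G \<longleftrightarrow> regular_graph 3 G \<and> arc_transitive (with_proj G)"

definition bipartite :: "'a pair_pre_digraph \<Rightarrow> bool" where
  "bipartite G \<longleftrightarrow>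
     (\<exists>U W. pverts G = U \<union> W \<and> U \<inter> W = {} \<and> parcs G \<subseteq> U \<times> W \<union> W \<times> U)"

definition vertex_ordering :: "'a pair_pre_digraph \<Rightarrow> (nat \<Rightarrow> 'a) \<Rightarrow> bool" where
  "vertex_ordering G v \<longleftrightarrow> bij_betw v {..<card (pverts G)} (pverts G)"

definition adjacency_matrix ::
    "'a pair_pre_digraph \<Rightarrow> (nat \<Rightarrow> 'a) \<Rightarrow> 'r :: zero_neq_one mat" where
  "adjacency_matrix G v =
     mat (card (pverts G)) (card (pverts G)) (\<lambda>(i, j). if (v i, v j) \<in> parcs G then 1 else 0)"

text \<open>
  The type \<open>bit\<close> is the field with two elements. The matrix \<open>H\<close>, and hence the code, depends on
  the chosen ordering of the vertices; \<open>graph_parity_check n G H\<close> holds for the matrices arising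
  from all admissible orderings.
\<close>

definition graph_parity_check :: "nat \<Rightarrow> 'a pair_pre_digraph \<Rightarrow> bit mat \<Rightarrow> bool" where
  "graph_parity_check n G H \<longleftrightarrow>
     H \<in> carrier_mat n n \<and>
     (\<exists>v. vertex_ordering G v \<and>
          adjacency_matrix G v = four_block_mat (0\<^sub>m n n) H (transpose_mat H) (0\<^sub>m n n))"

definition parity_check_code :: "bit mat \<Rightarrow> bit vec set" where
  "parity_check_code H = mat_kernel H"

definition code_dim :: "nat \<Rightarrow> bit vec set \<Rightarrow> nat" where
  "code_dim n C = vectorspace.dim class_ring ((module_vec TYPE(bit) n)\<lparr>carrier := C\<rparr>)"

end

theory Submission
  imports Defs
begin

text \<open>
  The rank of the parity-check matrix \<open>H\<close> is at least \<open>n / 3\<close>, because its rows are sparse and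
  leave no column empty. A vertex of a cubic graph has three neighbours, so a row of \<open>H\<close>
  has at most three nonzero entries and a column has at least one. Take an inclusion-minimal set of
  rows whose supports cover all \<open>n\<close> columns. It has at least \<open>n / 3\<close> members, and by minimality
  each of them covers a private column, in which the other rows of the set vanish; fix one such
  column per row (\<open>private_points_of_cover\<close>). Row \<open>i\<close> of the equation \<open>H x = 0\<close> then expresses the
  coordinate of a codeword \<open>x\<close> at the column fixed for \<open>i\<close> through coordinates outside the fixed
  columns. Hence a codeword is determined by its coordinates there, and the dimension is at most \<open>n\<close>
  minus the number of fixed columns (\<open>dim_kernel_plus_private_columns_le\<close>).

  This gives the bound \<open>2 n / 3\<close>, which is below \<open>5 n / 6\<close>.
\<close>

lemma (in linear_map) dim_le_if_inj:
  assumes fin_V: "V.fin_dim" and fin_W: "W.fin_dim" and inj: "inj_on T (carrier V)"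
  shows "V.dim \<le> W.dim"
proof -
  obtain B where fin: "finite B" and B: "V.basis B"
    using V.finite_basis_exists[OF fin_V] by blast
  have sub: "B \<subseteq> carrier V" and indep: "V.module.lin_indpt B"
    using B unfolding V.basis_def by auto
  have TB: "T ` B \<subseteq> carrier W" using sub by auto
  have "W.module.lin_indpt (T ` B)"
  proof (rule W.module.finite_lin_indpt2)
    fix a assume a: "a \<in> T ` B \<rightarrow> carrier K" and zero: "W.module.lincomb a (T ` B) = \<zero>\<^bsub>W\<^esub>"
    have aT: "a \<circ> T \<in> B \<rightarrow> carrier K" using a by auto
    have "T (V.module.lincomb (a \<circ> T) B) = T \<zero>\<^bsub>V\<^esub>"
      using lincomb_linear_image[OF inj sub a fin] zero by simp
    then have "V.module.lincomb (a \<circ> T) B = \<zero>\<^bsub>V\<^esub>"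
      using inj_onD[OF inj] V.module.lincomb_closed[OF sub aT] by simp
    then have "a \<circ> T \<in> B \<rightarrow> {\<zero>\<^bsub>K\<^esub>}"
      using V.not_lindepD[OF indep fin subset_refl aT] by blast
    then show "\<forall>w\<in>T ` B. a w = \<zero>\<^bsub>K\<^esub>" by auto
  qed (use fin TB in auto)
  then have "card (T ` B) \<le> W.dim" using W.li_le_dim(2)[OF fin_W TB] by blast
  moreover have "card (T ` B) = card B" using inj_on_subset[OF inj sub] by (rule card_image)
  ultimately show ?thesis using V.dim_basis[OF fin B] by simp
qed

text \<open>
  Row \<open>i\<close> involves the unknown at \<open>p\<close> and no other unknown with index in \<open>P\<close>, so two kernel
  vectors that agree off \<open>P\<close> also agree at \<open>p\<close>. Deleting the coordinates in \<open>P\<close> is therefore an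
  injective linear map on the kernel.
\<close>
lemma dim_kernel_plus_private_columns_le:
  fixes A :: "'a :: field mat"
  assumes A: "A \<in> carrier_mat nr nc" and P: "P \<subseteq> {..<nc}"
    and alone: "\<And>p. p \<in> P \<Longrightarrow> \<exists>i<nr. A $$ (i, p) \<noteq> 0 \<and> (\<forall>q\<in>P - {p}. A $$ (i, q) = 0)"
  shows "kernel.dim nc A + card P \<le> nc"
proof -
  interpret kernel nr nc A by unfold_locales (rule A)
  define qs where "qs = sorted_list_of_set ({..<nc} - P)"
  define m where "m = length qs"
  define T :: "'a vec \<Rightarrow> 'a vec" where "T v = vec m (\<lambda>k. v $ (qs ! k))" for v
  have set_qs: "set qs = {..<nc} - P" by (simp add: qs_def)
  have m: "m = nc - card P"
    using P by (simp add: m_def qs_def card_Diff_subset finite_subset)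
  have nth_qs: "qs ! k < nc" if "k < m" for k
    using nth_mem[of k qs] that set_qs m_def by auto
  have T_eqD: "v $ q = w $ q" if "T v = T w" "q < nc" "q \<notin> P" for v w q
  proof -
    obtain k where k: "k < m" "qs ! k = q"
      using \<open>q < nc\<close> \<open>q \<notin> P\<close> set_qs unfolding m_def by (metis DiffI in_set_conv_nth lessThan_iff)
    have "T v $ k = T w $ k" using that by simp
    then show ?thesis using k by (simp add: T_def)
  qed
  have inj: "inj_on T (mat_kernel A)"
  proof (rule inj_onI)
    fix v w assume v: "v \<in> mat_kernel A" and w: "w \<in> mat_kernel A" and eq: "T v = T w"
    note v = mat_kernelD[OF A v] and w = mat_kernelD[OF A w]
    show "v = w"
    proof (rule eq_vecI)
      fix p assume "p < dim_vec w"
      then have p: "p < nc" using w by simp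
      show "v $ p = w $ p"
      proof (cases "p \<in> P")
        case True
        then obtain i where i: "i < nr" and ip: "A $$ (i, p) \<noteq> 0"
          and iq: "\<And>q. q \<in> P - {p} \<Longrightarrow> A $$ (i, q) = 0"
          using alone by blast
        have row: "A $$ (i, p) * u $ p + (\<Sum>q\<in>{..<nc} - {p}. A $$ (i, q) * u $ q) = 0"
          if u: "u \<in> carrier_vec nc" "A *\<^sub>v u = 0\<^sub>v nr" for u
        proof -
          have "A $$ (i, p) * u $ p + (\<Sum>q\<in>{..<nc} - {p}. A $$ (i, q) * u $ q) =
              (\<Sum>q<nc. A $$ (i, q) * u $ q)"
            using p by (subst (2) sum.remove[of _ p]) auto
          also have "\<dots> = (A *\<^sub>v u) $ i"
            using A u(1) i by (simp add: scalar_prod_def lessThan_atLeast0)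
          also have "\<dots> = 0" unfolding u(2) using i by simp
          finally show ?thesis .
        qed
        have "(\<Sum>q\<in>{..<nc} - {p}. A $$ (i, q) * v $ q) = (\<Sum>q\<in>{..<nc} - {p}. A $$ (i, q) * w $ q)"
        proof (rule sum.cong)
          fix q assume "q \<in> {..<nc} - {p}"
          then show "A $$ (i, q) * v $ q = A $$ (i, q) * w $ q"
            using T_eqD[OF eq, of q] iq[of q] by (cases "q \<in> P") auto
        qed simp
        then have "A $$ (i, p) * v $ p = A $$ (i, p) * w $ p"
          using row[OF v] row[OF w] by (metis add_right_cancel)
        then show ?thesis using ip by simp
      qed (use T_eqD[OF eq] p in blast)
    qed (use v w in simp)
  qed
  interpret W: vec_space "TYPE('a)" m .
  have "linear_map class_ring VK W.V T"
  proof (unfold_locales, goal_cases)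
    case 1
    show ?case
      using nth_qs mat_kernel_carrier[OF A]
      by (auto simp: LinearCombinations.module_hom_def T_def module_vec_simps intro!: eq_vecI)
  qed
  then interpret L: linear_map class_ring VK W.V T .
  have "Ker.fin_dim"
    using kernel_basis_exists[OF A] unfolding Ker.fin_dim_def Ker.basis_def by blast
  then have "dim \<le> W.dim" using L.dim_le_if_inj inj by simp
  then show ?thesis
    using m W.dim_is_n card_mono[OF _ P] by simp
qed

text \<open>
  The set \<open>P\<close> picks one private point for each member of a minimal subcover; as those members have
  at most \<open>d\<close> points each, a cover of \<open>X\<close> needs at least \<open>card X / d\<close> of them.
\<close>
lemma private_points_of_cover:
  assumes "finite I" and cover: "X \<subseteq> (\<Union>i\<in>I. F i)"
    and fin: "\<And>i. i \<in> I \<Longrightarrow> finite (F i)" and small: "\<And>i. i \<in> I \<Longrightarrow> card (F i) \<le> d"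
  obtains P where "P \<subseteq> X" "card X \<le> d * card P" "\<And>p. p \<in> P \<Longrightarrow> \<exists>i\<in>I. F i \<inter> P = {p}"
proof -
  obtain S where S: "S \<subseteq> I" "X \<subseteq> (\<Union>i\<in>S. F i)"
    and minimal: "\<And>S'. S' \<subseteq> I \<Longrightarrow> X \<subseteq> (\<Union>i\<in>S'. F i) \<Longrightarrow> S' \<subseteq> S \<Longrightarrow> S' = S"
  proof -
    define covers where "covers = {S. S \<subseteq> I \<and> X \<subseteq> (\<Union>i\<in>S. F i)}"
    have "finite covers" using \<open>finite I\<close> by (simp add: covers_def)
    moreover have "I \<in> covers" using cover by (simp add: covers_def)
    ultimately obtain S where "S \<in> covers" "\<forall>S'\<in>covers. S' \<subseteq> S \<longrightarrow> S = S'"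
      using finite_has_minimal[of covers] by blast
    then show thesis by (intro that[of S]) (auto simp: covers_def)
  qed
  have "\<exists>x\<in>X. x \<notin> (\<Union>j\<in>S - {i}. F j)" if "i \<in> S" for i
    using minimal[of "S - {i}"] S(1) that by blast
  then obtain p where p: "\<And>i. i \<in> S \<Longrightarrow> p i \<in> X"
    and unique: "\<And>i j. i \<in> S \<Longrightarrow> j \<in> S \<Longrightarrow> p i \<in> F j \<Longrightarrow> j = i"
    by (metis DiffI UN_I singletonD)
  have own: "p i \<in> F i" if "i \<in> S" for i
    using p[OF that] S(2) unique[OF that] by auto
  have "inj_on p S" by (metis inj_onI own unique)
  then have card: "card (p ` S) = card S" by (rule card_image)
  have finS: "finite S" using S(1) \<open>finite I\<close> finite_subset by blast
  have "card X \<le> card (\<Union>i\<in>S. F i)"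
    using S finS fin by (intro card_mono) auto
  also have "\<dots> \<le> (\<Sum>i\<in>S. card (F i))" by (rule card_UN_le[OF finS])
  also have "\<dots> \<le> d * card S"
    using sum_bounded_above[of S "\<lambda>i. card (F i)" d] small S(1) by (auto simp: mult.commute)
  finally have "card X \<le> d * card (p ` S)" using card by simp
  moreover have "\<exists>i\<in>I. F i \<inter> p ` S = {x}" if "x \<in> p ` S" for x
    using that S(1) own unique by blast
  ultimately show thesis using that[of "p ` S"] p by blast
qed

lemma dim_kernel_le_if_sparse_rows:
  fixes A :: "'a :: field mat"
  assumes A: "A \<in> carrier_mat nr nc"
    and rows: "\<And>i. i < nr \<Longrightarrow> card {j. j < nc \<and> A $$ (i, j) \<noteq> 0} \<le> d"
    and cols: "\<And>j. j < nc \<Longrightarrow> \<exists>i<nr. A $$ (i, j) \<noteq> 0"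
  shows "nc + d * kernel.dim nc A \<le> d * nc"
proof -
  define supp where "supp i = {j. j < nc \<and> A $$ (i, j) \<noteq> 0}" for i
  have cover: "{..<nc} \<subseteq> (\<Union>i\<in>{..<nr}. supp i)"
    using cols by (auto simp: supp_def)
  have fin: "finite (supp i)" for i by (simp add: supp_def)
  have small: "card (supp i) \<le> d" if "i \<in> {..<nr}" for i
    using rows that by (simp add: supp_def)
  obtain P where P: "P \<subseteq> {..<nc}" "card {..<nc} \<le> d * card P"
    and single: "\<And>p. p \<in> P \<Longrightarrow> \<exists>i\<in>{..<nr}. supp i \<inter> P = {p}"
    using private_points_of_cover[OF finite_lessThan cover fin small] by blast
  have "\<exists>i<nr. A $$ (i, p) \<noteq> 0 \<and> (\<forall>q\<in>P - {p}. A $$ (i, q) = 0)" if "p \<in> P" for p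
    using single[OF that] P(1) unfolding supp_def by blast
  then have "kernel.dim nc A + card P \<le> nc"
    by (rule dim_kernel_plus_private_columns_le[OF A P(1)])
  then have "d * kernel.dim nc A + d * card P \<le> d * nc"
    by (metis add_mult_distrib2 mult_le_mono2)
  then show ?thesis using P(2) by simp
qed

text \<open>
  The two zero blocks of the adjacency matrix confine the neighbours of a vertex to the other half of
  the ordering, so row \<open>i\<close> of \<open>H\<close> records all neighbours of vertex \<open>i\<close> and column \<open>j\<close> all
  neighbours of vertex \<open>n + j\<close>.
\<close>
lemma graph_parity_check_rows_cols:
  assumes reg: "regular_graph k G" and "k > 0" and card: "card (pverts G) = 2 * n"
    and H: "graph_parity_check n G H"
  shows "\<And>i. i < n \<Longrightarrow> card {j. j < n \<and> H $$ (i, j) \<noteq> 0} \<le> k"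
    and "\<And>j. j < n \<Longrightarrow> \<exists>i<n. H $$ (i, j) \<noteq> 0"
proof -
  interpret pair_graph G using reg by (simp add: regular_graph_def)
  obtain v where HC: "H \<in> carrier_mat n n" and v: "bij_betw v {..<2 * n} (pverts G)"
    and adj: "adjacency_matrix G v = four_block_mat (0\<^sub>m n n) H (transpose_mat H) (0\<^sub>m n n)"
    using H card unfolding graph_parity_check_def vertex_ordering_def by auto
  have degree: "card {e \<in> parcs G. fst e = v a} = k" if "a < 2 * n" for a
    using reg bij_betwE[OF v] that
    by (auto simp: regular_graph_def out_degree_def out_arcs_def)
  have entry: "(v a, v b) \<in> parcs G \<longleftrightarrow>
      (if a < n then n \<le> b \<and> H $$ (a, b - n) \<noteq> 0 else b < n \<and> H $$ (b, a - n) \<noteq> 0)"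
    if ab: "a < 2 * n" "b < 2 * n" for a b
  proof -
    have "(v a, v b) \<in> parcs G \<longleftrightarrow> (adjacency_matrix G v :: bit mat) $$ (a, b) \<noteq> 0"
      using ab by (simp add: adjacency_matrix_def card)
    then show ?thesis
      using ab HC unfolding adj by auto
  qed
  show "card {j. j < n \<and> H $$ (i, j) \<noteq> 0} \<le> k" if i: "i < n" for i
  proof -
    have "card {j. j < n \<and> H $$ (i, j) \<noteq> 0} \<le> card {e \<in> parcs G. fst e = v i}"
    proof (rule card_inj_on_le)
      show "inj_on (\<lambda>j. (v i, v (n + j))) {j. j < n \<and> H $$ (i, j) \<noteq> 0}"
        using inj_onD[OF bij_betw_imp_inj_on[OF v], of "n + _" "n + _"] by (auto intro!: inj_onI)
      show "(\<lambda>j. (v i, v (n + j))) ` {j. j < n \<and> H $$ (i, j) \<noteq> 0} \<subseteq> {e \<in> parcs G. fst e = v i}"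
        using i by (auto simp: entry)
    qed (use pair_finite_arcs in simp)
    then show ?thesis using degree i by simp
  qed
  show "\<exists>i<n. H $$ (i, j) \<noteq> 0" if j: "j < n" for j
  proof -
    have "{e \<in> parcs G. fst e = v (n + j)} \<noteq> {}"
      using degree[of "n + j"] j \<open>k > 0\<close> by force
    then obtain w where w: "(v (n + j), w) \<in> parcs G" by auto
    then obtain b where "b < 2 * n" "w = v b"
      using v in_arcsD2 by (metis bij_betw_imp_surj_on imageE lessThan_iff)
    then show ?thesis using w entry[of "n + j" b] j by auto
  qed
qed

theorem theorem8:
  fixes G :: "'a pair_pre_digraph" and n :: nat and H :: "bit mat"
  assumes "n \<ge> 7"
    and "cubic_symmetric_graph G"
    and "Digraph_Component.connected (with_proj G)"
    and "bipartite G"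
    and "card (pverts G) = 2 * n"
    and "graph_parity_check n G H"
  shows "real (code_dim n (parity_check_code H)) \<le> 5 * real n / 6"
proof -
  have reg: "regular_graph 3 G" using assms(2) by (simp add: cubic_symmetric_graph_def)
  have H: "H \<in> carrier_mat n n" using assms(6) by (simp add: graph_parity_check_def)
  have "n + 3 * kernel.dim n H \<le> 3 * n"
    by (rule dim_kernel_le_if_sparse_rows[OF H])
       (use graph_parity_check_rows_cols[OF reg _ assms(5,6)] in auto)
  then show ?thesis by (simp add: code_dim_def parity_check_code_def)
qed

end
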